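(* Let $1\le k\le n$, and let $f$ be a real-valued differentiable function on a neighborhood $\mathrm{St}_\delta(k,n)$ of $\mathrm{St}(k,n)$. Let $P_*\in\mathrm{St}(k,n)$ be a maximizer of $\max_{P\in\mathrm{St}(k,n)}f(P)$. Suppose that the NEPv Ansatz holds for $f$ with a symmetric matrix-valued function $H(P)\in\mathbb{R}^{n\times n}$ and a subset $\mathbb{P}\subseteq\mathrm{St}(k,n)$, and that $P_*\in\mathbb{P}$. Then $$H(P_* )P_*=P_*\Omega_*,\qquad \Omega_*:=P_*^{\mathrm T}H(P_* )P_*,$$ and the eigenvalues of $\Omega_*$ consist of the first $k$ largest eigenvalues of $H(P_* )$ (counted with multiplicities).
   Context: $\mathrm{St}(k,n)=\{P\in\mathbb{R}^{n\times k}: P^{\mathrm T}P=I_k\}$; $\mathrm{St}_\delta(k,n)=\{P\in\mathbb{R}^{n\times k}:\|P^{\mathrm T}P-I_k\|<\delta\}$ for some $\delta>0$ and some matrix norm. NEPv Ansatz (for $f$ with a symmetric matrix-valued function $H(P)\in\mathbb{R}^{n\times n}$, $P\in\mathrm{St}(k,n)$, and a subset $\mathbb{P}\subseteq\mathrm{St}(k,n)$): there is a constant $\omega>0$ (independent of $P$ and $\widehat P$) such that whenever $P\in\mathbb{P}$, $\widehat P\in\mathrm{St}(k,n)$ and $\eta\in\mathbb{R}$ satisfy $$\mathrm{tr}(\widehat P^{\mathrm T}H(P)\widehat P)\ge\mathrm{tr}(P^{\mathrm T}H(P)P)+\eta,$$ there exists $Q\in\mathrm{St}(k,k)$ such that $\widetilde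 P=\widehat PQ\in\mathbb{P}$ and $f(\widetilde P)\ge f(P)+\omega\eta$. *)

theory Defs
  imports "HOL-Analysis.Analysis" "HOL-Computational_Algebra.Polynomial"
begin

(* The real n x k matrices are real^'k^'n (rows are indexed by 'n), with CARD('n) = n
   and CARD('k) = k. *)

definition stiefel :: "(real^'k^'n) set" where
  "stiefel = {P. transpose P ** P = mat 1}"

(* Submultiplicativity is not required, so both readings of "matrix norm" are covered. *)
definition matrix_norm :: "(real^'m^'n \<Rightarrow> real) \<Rightarrow> bool" where
  "matrix_norm N \<longleftrightarrow>
     (\<forall>A. 0 \<le> N A) \<and> (\<forall>A. N A = 0 \<longleftrightarrow> A = 0) \<and>
     (\<forall>c A. N (c *\<^sub>R A) = \<bar>c\<bar> * N A) \<and> (\<forall>A B. N (A + B) \<le> N A + N B)"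

definition stiefel_nbhd :: "(real^'k^'k \<Rightarrow> real) \<Rightarrow> real \<Rightarrow> (real^'k^'n) set" where
  "stiefel_nbhd N \<delta> = {P. N (transpose P ** P - mat 1) < \<delta>}"

definition nepv_ansatz ::
  "(real^'k^'n \<Rightarrow> real) \<Rightarrow> (real^'k^'n \<Rightarrow> real^'n^'n) \<Rightarrow> (real^'k^'n) set \<Rightarrow> bool" where
  "nepv_ansatz f H PP \<longleftrightarrow>
     (\<exists>\<omega>>0. \<forall>P\<in>PP. \<forall>P'\<in>stiefel. \<forall>\<eta>::real.
        trace (transpose P' ** H P ** P') \<ge> trace (transpose P ** H P ** P) + \<eta> \<longrightarrow>
        (\<exists>Q\<in>(stiefel :: (real^'k^'k) set). P' ** Q \<in> PP \<and> f (P' ** Q) \<ge> f P + \<omega> * \<eta>))"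

(* det (x I - A), the determinant being taken over the ring of polynomials in x *)
definition charpoly :: "real^'n^'n \<Rightarrow> real poly" where
  "charpoly A = det (\<chi> i j. (if i = j then [:0, 1:] else 0) - [:A $ i $ j:])"

lemma poly_charpoly: "poly (charpoly A) x = det (mat x - A)"
  by (auto simp: charpoly_def det_def mat_def poly_sum poly_prod of_int_poly
           intro!: sum.cong prod.cong)

(* Real eigenvalues with algebraic multiplicity. Only used for symmetric matrices, whose
   characteristic polynomial splits over the reals, so that no eigenvalue is missing. *)
definition eigenvalues :: "real^'n^'n \<Rightarrow> real multiset" where
  "eigenvalues A = proots (charpoly A)"

definition eigenvalues_desc :: "real^'n^'n \<Rightarrow> real list" where
  "eigenvalues_desc A = rev (sorted_list_of_multiset (eigenvalues A))"

end

theory Submission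
  imports Defs
begin

(* If P_0 maximizes f, the Ansatz forces P_0 to maximize the trace of P^T A P, A = H(P_0), over
   the Stiefel manifold.  Rotating one direction M v of the range of M = P_0 towards a vector w of
   its orthogonal complement keeps the matrix on the Stiefel manifold; the first-order condition
   at angle 0 gives invariance of the range under A, and comparing the angles 0 and pi/2
   shows that the eigenvalues of A on the range dominate those on the complement.  The
   spectral theorem on the range and on the complement then yields all eigenvalues of A. *)

section \<open>Symmetric quadratic forms and the spectral theorem\<close>

declare transpose_matrix_vector [simp del]

text \<open>For small \<open>t\<close> with the sign of \<open>b\<close> the linear term outweighs
  the quadratic one. This serves as the first-order condition at a maximum, without
  derivatives.\<close>

lemma linear_coeff_zero_if_quadratic_nonpos:
  fixes a b :: real
  assumes "\<And>t. 2 * t * b + t\<^sup>2 * a \<le> 0"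
  shows "b = 0"
proof (rule ccontr)
  assume "b \<noteq> 0"
  \<comment> \<open>Chosen so that \<open>b = t * (1 + \<bar>a\<bar>)\<close>, which turns the
    expression into \<open>t\<^sup>2\<close> times a positive factor.\<close>
  define t where "t = b / (1 + \<bar>a\<bar>)"
  have "b = t * (1 + \<bar>a\<bar>)"
    by (simp add: t_def add_pos_nonneg less_imp_neq[symmetric])
  then have "2 * t * b + t\<^sup>2 * a = t\<^sup>2 * (2 * (1 + \<bar>a\<bar>) + a)"
    by (simp add: algebra_simps power2_eq_square)
  moreover have "t\<^sup>2 > 0" "2 * (1 + \<bar>a\<bar>) + a > 0"
    using \<open>b \<noteq> 0\<close> by (auto simp: t_def)
  ultimately show False
    using assms[of t] by (metis mult_pos_pos not_le)
qed

lemma symmetric_inner_commute: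
  fixes A :: "real^'n^'n"
  assumes "transpose A = A"
  shows "(A *v x) \<bullet> y = x \<bullet> (A *v y)"
  by (metis assms dot_lmul_matrix vector_transpose_matrix)

lemma quadratic_form_add_scaleR:
  fixes A :: "real^'n^'n"
  assumes "transpose A = A"
  shows "(x + t *\<^sub>R w) \<bullet> (A *v (x + t *\<^sub>R w)) =
    x \<bullet> (A *v x) + 2 * t * ((A *v x) \<bullet> w) + t\<^sup>2 * (w \<bullet> (A *v w))"
  using symmetric_inner_commute[OF assms, of x w]
  by (simp add: matrix_vector_right_distrib matrix_vector_mult_scaleR inner_add_left
      inner_add_right power2_eq_square inner_commute algebra_simps)

text \<open>A maximizer of \<open>x \<bullet> (A *v x)\<close> on the compact unit sphere of
  \<open>V\<close> is an eigenvector, because the form is stationary there in all directions of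
  \<open>V\<close> orthogonal to it.\<close>

lemma symmetric_matrix_eigenvector:
  fixes A :: "real^'n^'n"
  assumes sym: "transpose A = A" and V: "subspace V" and inv: "\<And>x. x \<in> V \<Longrightarrow> A *v x \<in> V"
    and "V \<noteq> {0}"
  obtains x l where "x \<in> V" "norm x = 1" "A *v x = l *\<^sub>R x"
proof -
  let ?S = "V \<inter> sphere 0 1"
  have "compact ?S"
    using closed_subspace[OF V] by (simp add: closed_Int_compact)
  moreover obtain y where "y \<in> V" "y \<noteq> 0"
    using assms(4) subspace_0[OF V] by auto
  then have "y /\<^sub>R norm y \<in> ?S"
    using V by (auto simp: subspace_scale)
  then have "?S \<noteq> {}" by blast
  moreover have "continuous_on ?S (\<lambda>x. x \<bullet> (A *v x))"
    by (intro continuous_intros)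
  ultimately have "\<exists>x\<in>?S. \<forall>z\<in>?S. z \<bullet> (A *v z) \<le> x \<bullet> (A *v x)"
    by (rule continuous_attains_sup)
  then obtain x where x: "x \<in> V" "norm x = 1"
    and max: "\<And>z. z \<in> ?S \<Longrightarrow> z \<bullet> (A *v z) \<le> x \<bullet> (A *v x)"
    by auto
  define a where "a = x \<bullet> (A *v x)"
  \<comment> \<open>Homogeneity carries the bound from the unit sphere to all of
    \<open>V\<close>.\<close>
  have le: "z \<bullet> (A *v z) \<le> a * (norm z)\<^sup>2" if "z \<in> V" for z
  proof (cases "z = 0")
    case False
    then have "(z /\<^sub>R norm z) \<bullet> (A *v (z /\<^sub>R norm z)) \<le> a"
      unfolding a_def using that V by (intro max) (auto simp: subspace_scale)
    then show ?thesis
      using False by (simp add: matrix_vector_mult_scaleR field_simps power2_eq_square)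
  qed simp
  have orth: "(A *v x) \<bullet> w = 0" if w: "w \<in> V" "x \<bullet> w = 0" for w
  proof (rule linear_coeff_zero_if_quadratic_nonpos)
    fix t
    have "x + t *\<^sub>R w \<in> V"
      using V x w by (simp add: subspace_add subspace_scale)
    moreover have "(norm (x + t *\<^sub>R w))\<^sup>2 = 1 + t\<^sup>2 * (norm w)\<^sup>2"
      using x w by (simp add: norm_add_Pythagorean orthogonal_def power_mult_distrib)
    ultimately show "2 * t * ((A *v x) \<bullet> w) + t\<^sup>2 * (w \<bullet> (A *v w) - a * (norm w)\<^sup>2) \<le> 0"
      using le[of "x + t *\<^sub>R w"] quadratic_form_add_scaleR[OF sym, of x t w]
      by (simp add: a_def algebra_simps)
  qed
  \<comment> \<open>The residual lies in \<open>V\<close> and is orthogonal to \<open>x\<close>, so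
    by \<open>orth\<close> it is orthogonal to \<open>A *v x\<close> and hence to itself.\<close>
  define w where "w = A *v x - a *\<^sub>R x"
  have "x \<bullet> x = 1"
    using x by (simp add: norm_eq_1)
  then have xw: "x \<bullet> w = 0"
    by (simp add: w_def a_def inner_diff_right)
  have "w \<in> V"
    unfolding w_def using V x inv by (simp add: subspace_diff subspace_scale)
  then have "w \<bullet> w = 0"
    using orth[of w] xw by (simp add: w_def inner_diff_left)
  then have "A *v x = a *\<^sub>R x" by (simp add: w_def)
  with x that show thesis by blast
qed

text \<open>Eigenvalues are a function of the eigenvector, so that families can be united as plain
  sets and a repeated eigenvalue is counted through distinct vectors.\<close>

definition orthonormal_eigenset :: "real^'n^'n \<Rightarrow> (real^'n \<Rightarrow> real) \<Rightarrow> (real^'n) set \<Rightarrow> bool" where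
  "orthonormal_eigenset A l B \<longleftrightarrow> finite B \<and>
     (\<forall>x\<in>B. \<forall>y\<in>B. x \<bullet> y = (if x = y then 1 else 0)) \<and> (\<forall>x\<in>B. A *v x = l x *\<^sub>R x)"

lemma orthonormal_eigenset_independent:
  assumes "orthonormal_eigenset A l B"
  shows "independent B"
proof (rule pairwise_orthogonal_independent)
  show "pairwise orthogonal B"
    using assms by (simp add: orthonormal_eigenset_def pairwise_def orthogonal_def)
  show "0 \<notin> B"
    using assms unfolding orthonormal_eigenset_def by force
qed

lemma orthonormal_eigenset_card:
  fixes A :: "real^'n^'n"
  assumes "orthonormal_eigenset A l B" and "span B = UNIV"
  shows "card B = CARD('n)"
  using dim_span_eq_card_independent[OF orthonormal_eigenset_independent[OF assms(1)]] assms(2)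
  by simp

text \<open>Induction on the dimension: split off a unit eigenvector and continue in its orthogonal
  complement within \<open>V\<close>. Besides the whole space, the result is later applied to a
  kernel.\<close>

theorem symmetric_matrix_eigenbasis:
  fixes A :: "real^'n^'n"
  assumes sym: "transpose A = A" and "subspace V" and "\<And>x. x \<in> V \<Longrightarrow> A *v x \<in> V"
  shows "\<exists>B l. orthonormal_eigenset A l B \<and> span B = V"
  using assms(2,3)
proof (induction "dim V" arbitrary: V rule: less_induct)
  case less
  show ?case
  proof (cases "V = {0}")
    case True
    then show ?thesis
      by (intro exI[of _ "{}"]) (simp add: orthonormal_eigenset_def)
  next
    case False
    then obtain x a where x: "x \<in> V" "norm x = 1" "A *v x = a *\<^sub>R x"
      using symmetric_matrix_eigenvector[OF sym less.prems] by blast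
    have xx: "x \<bullet> x = 1"
      using x by (simp add: norm_eq_1)
    define W where "W = {y \<in> V. x \<bullet> y = 0}"
    have W: "subspace W"
      using less.prems(1) by (auto simp: W_def subspace_def inner_add_right)
    have "x \<notin> W" using xx by (simp add: W_def)
    moreover have "W \<subseteq> V" by (auto simp: W_def)
    ultimately have "W \<subset> V" using x by blast
    then have "dim W < dim V"
      by (metis W less.prems(1) dim_psubset span_eq_iff)
    \<comment> \<open>Symmetry moves \<open>A\<close> onto the eigenvector:
      \<open>x \<bullet> (A *v y) = a * (x \<bullet> y) = 0\<close>.\<close>
    moreover have "A *v y \<in> W" if "y \<in> W" for y
      using that less.prems(2) symmetric_inner_commute[OF sym, of x y] x(3)
      by (auto simp: W_def)
    ultimately obtain B l where B: "orthonormal_eigenset A l B" "span B = W"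
      using less.hyps W by blast
    have "B \<subseteq> W" using B(2) span_superset by blast
    then have xB: "x \<notin> B" and orth: "\<And>y. y \<in> B \<Longrightarrow> x \<bullet> y = 0"
      using \<open>x \<notin> W\<close> by (auto simp: W_def)
    then have "orthonormal_eigenset A (l(x := a)) (insert x B)"
      using B(1) x xx by (auto simp: orthonormal_eigenset_def inner_commute)
    moreover have "span (insert x B) = V"
    proof
      show "span (insert x B) \<subseteq> V"
        using x \<open>B \<subseteq> W\<close> less.prems(1) by (intro span_minimal) (auto simp: W_def)
      show "V \<subseteq> span (insert x B)"
      proof
        fix y assume "y \<in> V"
        then have "y - (x \<bullet> y) *\<^sub>R x \<in> W"
          using x less.prems(1) xx
          by (simp add: W_def subspace_diff subspace_scale inner_diff_right)
        then show "y \<in> span (insert x B)"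
          using B(2) by (auto simp: span_insert)
      qed
    qed
    ultimately show ?thesis by blast
  qed
qed

section \<open>Eigenvalue multisets and their largest elements\<close>

text \<open>The vectors of \<open>B\<close> are the columns of a matrix diagonalizing
  \<open>A\<close>, so the characteristic polynomial has one factor \<open>x - l v\<close> for each
  \<open>v\<close> in \<open>B\<close>.\<close>

lemma eigenvalues_orthonormal_eigenset:
  fixes A :: "real^'n^'n"
  assumes B: "orthonormal_eigenset A l B" and "card B = CARD('n)"
  shows "eigenvalues A = image_mset l (mset_set B)"
proof -
  have fin: "finite B" using B by (simp add: orthonormal_eigenset_def)
  obtain b where b: "bij_betw b (UNIV :: 'n set) B"
    using fin assms(2) by (metis finite_same_card_bij finite)
  have bB: "b i \<in> B" and b_eq: "b i = b j \<longleftrightarrow> i = j" for i j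
    using b by (auto simp: bij_betw_def inj_def)
  define U :: "real^'n^'n" where "U = (\<chi> i j. b j $ i)"
  define D :: "real \<Rightarrow> real^'n^'n" where "D = (\<lambda>x. \<chi> i j. if i = j then x - l (b i) else 0)"
  have "transpose U ** U = mat 1"
    using B bB b_eq
    by (simp add: vec_eq_iff U_def matrix_matrix_mult_def transpose_def mat_def
        orthonormal_eigenset_def inner_vec_def)
  then have detU: "det U \<noteq> 0"
    by (metis det_I det_mul mult_zero_right zero_neq_one)
  have AU: "(A ** U) $ i $ j = l (b j) * b j $ i" for i j
  proof -
    have "(A ** U) $ i $ j = (A *v b j) $ i"
      by (simp add: U_def matrix_matrix_mult_def matrix_vector_mult_def)
    then show ?thesis
      using B bB[of j] by (simp add: orthonormal_eigenset_def)
  qed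
  \<comment> \<open>Taking determinants and cancelling \<open>det U\<close> compares
    \<open>mat x - A\<close> with \<open>D x\<close> without inverting \<open>U\<close>.\<close>
  have "(mat x - A) ** U = U ** D x" for x
  proof -
    have "((mat x - A) ** U) $ i $ j = (mat x ** U) $ i $ j - (A ** U) $ i $ j" for i j
      by (simp add: matrix_matrix_mult_def left_diff_distrib sum_subtractf)
    moreover have "(mat x ** U) $ i $ j = x * U $ i $ j" for i j
      by (simp add: matrix_matrix_mult_def mat_def if_distrib[of "\<lambda>z. z * _"] sum.delta cong: if_cong)
    moreover have "(U ** D x) $ i $ j = (x - l (b j)) * b j $ i" for i j
      by (simp add: matrix_matrix_mult_def D_def U_def if_distrib[of "\<lambda>z. _ * z"] sum.delta cong: if_cong)
    ultimately show ?thesis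
      using AU by (simp add: vec_eq_iff U_def left_diff_distrib)
  qed
  then have "det (mat x - A) = det (D x)" for x
    using detU by (metis det_mul mult.commute mult_cancel_right)
  moreover have "det (D x) = (\<Prod>i\<in>UNIV. x - l (b i))" for x
    by (subst det_diagonal) (auto simp: D_def)
  moreover have "(\<Prod>i\<in>UNIV. x - l (b i)) = (\<Prod>v\<in>B. x - l v)" for x
    using b by (rule prod.reindex_bij_betw)
  \<comment> \<open>Agreement at every real number determines the polynomial, hence the
    multiplicities of its roots.\<close>
  ultimately have "poly (charpoly A) = poly (\<Prod>v\<in>B. [:- l v, 1:])"
    by (simp add: fun_eq_iff poly_charpoly poly_prod)
  then have "charpoly A = (\<Prod>v\<in>B. [:- l v, 1:])"
    using poly_eq_poly_eq_iff by blast
  moreover have "proots (\<Prod>v\<in>B. [:- l v, 1:]) = (\<Sum>v\<in>B. {#l v#})"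
    by (subst proots_prod) auto
  moreover have "(\<Sum>v\<in>B. {#l v#}) = image_mset l (mset_set B)"
    using fin by (induction B rule: finite_induct) auto
  ultimately show ?thesis
    by (simp add: eigenvalues_def)
qed

text \<open>Sorting puts \<open>Y\<close> before \<open>X\<close>, and reversal puts
  \<open>X\<close> first. Ties between the two are harmless, since equal entries are
  interchangeable.\<close>

lemma take_size_rev_sorted_list_of_multiset:
  assumes "\<And>x y. x \<in># X \<Longrightarrow> y \<in># Y \<Longrightarrow> y \<le> x"
  shows "mset (take (size X) (rev (sorted_list_of_multiset (X + Y)))) = X"
proof -
  let ?ys = "sorted_list_of_multiset Y @ sorted_list_of_multiset X"
  have "sorted ?ys"
    using assms by (simp add: sorted_append)
  then have "sorted_list_of_multiset (mset ?ys) = ?ys"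
    by (simp only: sorted_list_of_multiset_mset sorted_sort_id)
  then have "sorted_list_of_multiset (X + Y) = ?ys"
    by (simp add: add.commute)
  moreover have "length (sorted_list_of_multiset X) = size X"
    by (metis mset_sorted_list_of_multiset size_mset)
  ultimately show ?thesis by simp
qed

section \<open>Rank-one matrices\<close>

text \<open>The rank-one matrix \<open>u v^T\<close>; adding it to a matrix alters the action only
  along \<open>v\<close>.\<close>

definition outer :: "real^'n \<Rightarrow> real^'m \<Rightarrow> real^'m^'n" where
  "outer u v = (\<chi> i j. u $ i * v $ j)"

lemma transpose_outer: "transpose (outer u v) = outer v u"
  by (simp add: outer_def transpose_def mult.commute)

lemma matrix_mult_outer: "A ** outer u v = outer (A *v u) v"
  by (simp add: vec_eq_iff outer_def matrix_matrix_mult_def matrix_vector_mult_def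
      sum_distrib_right mult.assoc)

lemma outer_matrix_mult: "outer u v ** A = outer u (transpose A *v v)"
  by (simp add: vec_eq_iff outer_def matrix_matrix_mult_def matrix_vector_mult_def transpose_def
      sum_distrib_left mult_ac)

lemma outer_mult_vector: "outer u v *v x = (v \<bullet> x) *\<^sub>R u"
  by (simp add: vec_eq_iff outer_def matrix_vector_mult_def inner_vec_def
      sum_distrib_left mult_ac)

lemma trace_outer: "trace (outer u v) = u \<bullet> v"
  by (simp add: outer_def trace_def inner_vec_def)

lemma transpose_add: "transpose (A + B) = transpose A + transpose B"
  for A B :: "'a::plus^'n^'m"
  by (simp add: transpose_def vec_eq_iff)

lemma outer_add_left: "outer (u + u') v = outer u v + outer u' v"
  by (simp add: outer_def vec_eq_iff distrib_right)

lemma matrix_add_rdistrib: "(A + B) ** C = A ** C + B ** C"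
  by (simp add: matrix_matrix_mult_def vec_eq_iff distrib_right sum.distrib)

lemma inner_transpose_vector:
  fixes M :: "real^'k^'n"
  shows "(transpose M *v x) \<bullet> y = x \<bullet> (M *v y)"
  by (simp add: transpose_matrix_vector dot_lmul_matrix)

section \<open>Trace maximizers on the Stiefel manifold\<close>

lemma stiefel_transpose_cancel:
  assumes "M \<in> stiefel"
  shows "transpose M *v (M *v x) = x"
  using assms by (simp add: stiefel_def matrix_vector_mul_assoc)

lemma stiefel_inner:
  assumes "M \<in> stiefel"
  shows "(M *v x) \<bullet> (M *v y) = x \<bullet> y"
  by (simp add: stiefel_transpose_cancel[OF assms] flip: inner_transpose_vector)

(* The competitor is M with M v replaced by c M v + s w, i.e. M + u v^T. *)
lemma trace_maximizer_rotation:
  fixes A :: "real^'n^'n" and M :: "real^'k^'n"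
  assumes sym: "transpose A = A" and M: "M \<in> stiefel"
    and max: "\<And>P. P \<in> (stiefel :: (real^'k^'n) set) \<Longrightarrow>
      trace (transpose P ** A ** P) \<le> trace (transpose M ** A ** M)"
    and v: "norm v = 1" and w: "transpose M *v w = 0"
    and cs: "c\<^sup>2 + s\<^sup>2 * (norm w)\<^sup>2 = 1"
  shows "(c *\<^sub>R (M *v v) + s *\<^sub>R w) \<bullet> (A *v (c *\<^sub>R (M *v v) + s *\<^sub>R w))
    \<le> (M *v v) \<bullet> (A *v (M *v v))"
proof -
  \<comment> \<open>The change in the image of the unit vector \<open>v\<close>: \<open>P\<close>
    sends \<open>v\<close> to \<open>c *\<^sub>R (M *v v) + s *\<^sub>R w\<close> and agrees with
    \<open>M\<close> on vectors orthogonal to \<open>v\<close>.\<close>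
  define u where "u = (c - 1) *\<^sub>R (M *v v) + s *\<^sub>R w"
  define P where "P = M + outer u v"
  have vv: "v \<bullet> v = 1" using v by (simp add: norm_eq_1)
  have Mu: "transpose M *v u = (c - 1) *\<^sub>R v"
    using w stiefel_transpose_cancel[OF M]
    by (simp add: u_def matrix_vector_right_distrib matrix_vector_mult_scaleR)
  have "w \<bullet> (M *v v) = 0"
    using w by (metis inner_transpose_vector inner_zero_left)
  moreover from this have "(M *v v) \<bullet> w = 0"
    by (simp add: inner_commute)
  moreover have "(M *v v) \<bullet> (M *v v) = 1"
    using stiefel_inner[OF M] vv by simp
  moreover have "w \<bullet> w = (norm w)\<^sup>2"
    by (rule dot_square_norm)
  ultimately have "u \<bullet> u = (c - 1) * ((c - 1) * 1) + s * (s * (norm w)\<^sup>2)"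
    unfolding u_def inner_add_left inner_add_right inner_scaleR_left inner_scaleR_right by simp
  then have uu: "u \<bullet> u = 2 - 2 * c"
    using cs by (simp add: power2_eq_square algebra_simps)
  \<comment> \<open>All three corrections are multiples of \<open>outer v v\<close>; their
    coefficients add up to \<open>2 * (c - 1) + u \<bullet> u\<close>, which is zero by
    \<open>uu\<close>.\<close>
  have "transpose P ** P = mat 1 + (outer ((c - 1) *\<^sub>R v) v + outer v ((c - 1) *\<^sub>R v)
      + outer ((u \<bullet> u) *\<^sub>R v) v)"
    using M Mu
    by (simp add: P_def transpose_add transpose_outer matrix_add_ldistrib matrix_add_rdistrib
        matrix_mult_outer outer_matrix_mult outer_mult_vector outer_add_left
        matrix_vector_mult_add_rdistrib stiefel_def add_ac)
  also have "outer ((c - 1) *\<^sub>R v) v + outer v ((c - 1) *\<^sub>R v) + outer ((u \<bullet> u) *\<^sub>R v) v = 0"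
    unfolding uu by (simp add: outer_def vec_eq_iff algebra_simps)
  finally have "P \<in> stiefel" by (simp add: stiefel_def)
  have AMu: "(A *v u) \<bullet> (M *v v) = u \<bullet> (A *v (M *v v))"
    by (rule symmetric_inner_commute[OF sym])
  have "trace (transpose P ** A ** P) = trace (transpose M ** A ** M)
      + trace (transpose M ** A ** outer u v) + trace (outer v u ** A ** M)
      + trace (outer v u ** A ** outer u v)"
    by (simp add: P_def transpose_add transpose_outer matrix_add_ldistrib matrix_add_rdistrib
        trace_add)
  also have "trace (transpose M ** A ** outer u v) = u \<bullet> (A *v (M *v v))"
    by (simp add: matrix_mult_outer trace_outer inner_transpose_vector AMu
        flip: matrix_vector_mul_assoc)
  also have "trace (outer v u ** A ** M) = u \<bullet> (A *v (M *v v))"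
    using AMu sym by (simp add: outer_matrix_mult trace_outer inner_transpose_vector
        inner_commute[of v])
  also have "trace (outer v u ** A ** outer u v) = u \<bullet> (A *v u)"
    using vv sym by (simp add: outer_matrix_mult outer_mult_vector matrix_mult_outer trace_outer
        symmetric_inner_commute[OF sym])
  finally have "2 * (u \<bullet> (A *v (M *v v))) + u \<bullet> (A *v u) \<le> 0"
    using max[OF \<open>P \<in> stiefel\<close>] by simp
  \<comment> \<open>The gain in trace is the gain of the quadratic form from \<open>M *v v\<close>
    to \<open>M *v v + u\<close>; the factor \<open>1\<close> is the \<open>t\<close> of
    \<open>quadratic_form_add_scaleR\<close>.\<close>
  moreover have "c *\<^sub>R (M *v v) + s *\<^sub>R w = M *v v + 1 *\<^sub>R u"
    by (simp add: u_def algebra_simps)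
  ultimately show ?thesis
    unfolding quadratic_form_add_scaleR[OF sym] \<open>c *\<^sub>R (M *v v) + s *\<^sub>R w = M *v v + 1 *\<^sub>R u\<close>
    by (simp add: inner_commute[of "A *v (M *v v)"])
qed

text \<open>Rotating \<open>M *v v\<close> towards \<open>w\<close> cannot raise the form, so the
  cross term \<open>(A *v (M *v v)) \<bullet> w\<close> vanishes for every unit
  \<open>v\<close>.\<close>

lemma trace_maximizer_kernel_invariant:
  fixes A :: "real^'n^'n" and M :: "real^'k^'n"
  assumes sym: "transpose A = A" and M: "M \<in> stiefel"
    and max: "\<And>P. P \<in> (stiefel :: (real^'k^'n) set) \<Longrightarrow>
      trace (transpose P ** A ** P) \<le> trace (transpose M ** A ** M)"
    and w: "transpose M *v w = 0"
  shows "transpose M *v (A *v w) = 0"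
proof -
  have unit: "(A *v (M *v v)) \<bullet> w = 0" if v: "norm v = 1" for v
  proof (rule linear_coeff_zero_if_quadratic_nonpos)
    fix t
    let ?q = "\<lambda>z. z \<bullet> (A *v z)"
    \<comment> \<open>The squared norm of \<open>M *v v + t *\<^sub>R w\<close>; dividing by its
      root, the coefficients \<open>c\<close> and \<open>c * t\<close> meet the constraint of
      \<open>trace_maximizer_rotation\<close>.\<close>
    define r where "r = 1 + t\<^sup>2 * (norm w)\<^sup>2"
    have r: "r > 0" unfolding r_def by (rule add_pos_nonneg) auto
    define c where "c = 1 / sqrt r"
    have c2: "c\<^sup>2 = 1 / r" using r by (simp add: c_def power_divide)
    then have "c\<^sup>2 * r = 1" using r by simp
    then have "c\<^sup>2 + (c * t)\<^sup>2 * (norm w)\<^sup>2 = 1"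
      by (simp add: r_def power_mult_distrib algebra_simps)
    from trace_maximizer_rotation[OF sym M max v w this]
    have "?q (c *\<^sub>R (M *v v + t *\<^sub>R w)) \<le> ?q (M *v v)"
      by (simp add: scaleR_add_right)
    then have "c\<^sup>2 * ?q (M *v v + t *\<^sub>R w) \<le> ?q (M *v v)"
      by (simp only: matrix_vector_mult_scaleR inner_scaleR_left inner_scaleR_right
          power2_eq_square mult.assoc)
    then have "?q (M *v v + t *\<^sub>R w) \<le> ?q (M *v v) * r"
      using r by (simp add: c2 divide_le_eq)
    then show "2 * t * ((A *v (M *v v)) \<bullet> w)
        + t\<^sup>2 * (?q w - (norm w)\<^sup>2 * ?q (M *v v)) \<le> 0"
      unfolding quadratic_form_add_scaleR[OF sym] r_def by (simp add: algebra_simps)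
  qed
  \<comment> \<open>The unit case at the normalized \<open>?y\<close> gives
    \<open>?y \<bullet> ?y = (A *v (M *v ?y)) \<bullet> w = 0\<close>.\<close>
  let ?y = "transpose M *v (A *v w)"
  show ?thesis
  proof (rule ccontr)
    assume "?y \<noteq> 0"
    then have "(A *v (M *v (?y /\<^sub>R norm ?y))) \<bullet> w = 0"
      by (intro unit) simp
    then have "(A *v (M *v ?y)) \<bullet> w = 0"
      using \<open>?y \<noteq> 0\<close> by (simp add: matrix_vector_mult_scaleR)
    then have "?y \<bullet> ?y = 0"
      by (simp only: inner_transpose_vector symmetric_inner_commute[OF sym] inner_commute)
    then show False using \<open>?y \<noteq> 0\<close> by simp
  qed
qed

text \<open>The equality case of Ky Fan's trace principle: \<open>S\<close> represents
  \<open>A\<close> on the range of \<open>M\<close> in the orthonormal basis of columns of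
  \<open>M\<close>.\<close>

theorem trace_maximizer_eigenvalues:
  fixes A :: "real^'n^'n" and M :: "real^'k^'n"
  assumes sym: "transpose A = A" and M: "M \<in> stiefel"
    and max: "\<And>P. P \<in> (stiefel :: (real^'k^'n) set) \<Longrightarrow>
      trace (transpose P ** A ** P) \<le> trace (transpose M ** A ** M)"
  defines "S \<equiv> transpose M ** A ** M"
  shows "A ** M = M ** S"
    and "eigenvalues S = mset (take CARD('k) (eigenvalues_desc A))"
proof -
  define V where "V = {w. transpose M *v w = 0}"
  have subV: "subspace V"
    by (simp add: V_def subspace_def matrix_vector_right_distrib matrix_vector_mult_scaleR)
  have invV: "A *v w \<in> V" if "w \<in> V" for w
    using that trace_maximizer_kernel_invariant[OF sym M max] by (simp add: V_def)
  \<comment> \<open>\<open>M ** transpose M\<close> is the orthogonal projection onto the range of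
    \<open>M\<close>.\<close>
  have proj: "x - M *v (transpose M *v x) \<in> V" for x
    using stiefel_transpose_cancel[OF M] by (simp add: V_def matrix_vector_mult_diff_distrib)
  have orthV: "w \<bullet> (M *v y) = 0" if "w \<in> V" for w y
    using that inner_transpose_vector[of M w y] by (simp add: V_def)
  have S: "S *v y = transpose M *v (A *v (M *v y))" for y
    by (simp add: S_def matrix_vector_mul_assoc matrix_mul_assoc)
  \<comment> \<open>Invariance passes from \<open>V\<close> to the range of \<open>M\<close>: the
    residual lies in \<open>V\<close>, and so does its image under \<open>A\<close>, so it is
    orthogonal to both of its terms.\<close>
  have AM: "A *v (M *v y) = M *v (S *v y)" for y
  proof -
    let ?w = "A *v (M *v y) - M *v (S *v y)"
    have w: "?w \<in> V" using proj[of "A *v (M *v y)"] by (simp add: S)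
    then have "?w \<bullet> ?w = ?w \<bullet> (A *v (M *v y))"
      by (simp only: inner_diff_right orthV[OF w] diff_zero)
    also have "\<dots> = 0"
      using orthV[OF invV[OF w]] by (simp only: symmetric_inner_commute[OF sym])
    finally show ?thesis by simp
  qed
  show "A ** M = M ** S"
    by (simp add: matrix_eq AM flip: matrix_vector_mul_assoc)
  have "transpose S = S"
    by (simp add: S_def matrix_transpose_mul sym matrix_mul_assoc)
  from symmetric_matrix_eigenbasis[OF this, of UNIV]
  obtain B l where B: "orthonormal_eigenset S l B" "span B = UNIV" by auto
  from symmetric_matrix_eigenbasis[OF sym subV invV]
  obtain C m where C: "orthonormal_eigenset A m C" "span C = V" by blast
  have CV: "C \<subseteq> V" using C(2) span_superset by blast
  have cardB: "card B = CARD('k)"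
    by (rule orthonormal_eigenset_card[OF B])
  let ?D = "(*v) M ` B"
  have finB: "finite B" and finC: "finite C"
    using B C by (auto simp: orthonormal_eigenset_def)
  have unitB: "norm b = 1" if "b \<in> B" for b
    using that B(1) by (auto simp: orthonormal_eigenset_def norm_eq_1)
  have unitC: "norm b = 1" if "b \<in> C" for b
    using that C(1) by (auto simp: orthonormal_eigenset_def norm_eq_1)
  have inj: "inj ((*v) M)"
    by (metis injI stiefel_transpose_cancel[OF M])
  have disj: "?D \<inter> C = {}"
  proof -
    have "M *v b \<notin> V" if "b \<in> B" for b
      using orthV[of "M *v b" b] stiefel_inner[OF M, of b b] unitB[OF that] by (auto simp: norm_eq_1)
    then show ?thesis using CV by auto
  qed
  \<comment> \<open>Glues the two eigenvalue functions; off \<open>C\<close>,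
    \<open>transpose M\<close> recovers \<open>b\<close> from \<open>M *v b\<close>.\<close>
  define e where "e = (\<lambda>x. if x \<in> C then m x else l (transpose M *v x))"
  have eD: "e (M *v b) = l b" if "b \<in> B" for b
    using that disj stiefel_transpose_cancel[OF M] by (auto simp: e_def)
  have "orthonormal_eigenset A e (?D \<union> C)"
    unfolding orthonormal_eigenset_def
  proof (intro conjI ballI)
    show "finite (?D \<union> C)" using finB finC by simp
  next
    fix x y assume "x \<in> ?D \<union> C" "y \<in> ?D \<union> C"
    then consider b b' where "x = M *v b" "y = M *v b'" "b \<in> B" "b' \<in> B"
      | b where "x = M *v b" "b \<in> B" "y \<in> C"
      | b where "y = M *v b" "b \<in> B" "x \<in> C"
      | "x \<in> C" "y \<in> C" by blast
    then show "x \<bullet> y = (if x = y then 1 else 0)"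
    proof cases
      case 1
      then show ?thesis
        using B(1) inj stiefel_inner[OF M] by (simp add: orthonormal_eigenset_def inj_eq)
    next
      case 2
      then show ?thesis using disj CV orthV[of y b] by (auto simp: inner_commute)
    next
      case 3
      then show ?thesis using disj CV orthV[of x b] by auto
    next
      case 4
      then show ?thesis using C(1) by (simp add: orthonormal_eigenset_def)
    qed
  next
    fix x assume "x \<in> ?D \<union> C"
    then show "A *v x = e x *\<^sub>R x"
    proof
      assume "x \<in> ?D"
      then obtain b where b: "b \<in> B" "x = M *v b" by blast
      then have "S *v b = l b *\<^sub>R b" using B(1) by (simp add: orthonormal_eigenset_def)
      then show ?thesis using b eD AM by (simp add: matrix_vector_mult_scaleR)
    next
      assume "x \<in> C"
      then show ?thesis using C(1) by (simp add: e_def orthonormal_eigenset_def)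
    qed
  qed
  moreover have "span (?D \<union> C) = UNIV"
  proof -
    have "M *v y \<in> span ?D" for y
      using B(2) by (metis UNIV_I image_eqI linear_span_image matrix_vector_mul_linear)
    then have "M *v (transpose M *v x) + (x - M *v (transpose M *v x)) \<in> span (?D \<union> C)" for x
      using proj[of x] C(2)
      by (intro span_add) (meson span_mono subsetD sup_ge1 sup_ge2)+
    then show ?thesis by auto
  qed
  ultimately have eig: "eigenvalues A = image_mset e (mset_set (?D \<union> C))"
    by (simp add: eigenvalues_orthonormal_eigenset orthonormal_eigenset_card)
  \<comment> \<open>Disjointness and injectivity of \<open>M\<close> ensure that multiplicities add
    up.\<close>
  have "mset_set (?D \<union> C) = image_mset ((*v) M) (mset_set B) + mset_set C"
    using finB finC disj inj
    by (simp add: mset_set_Union image_mset_mset_set inj_on_subset)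
  then have "eigenvalues A = image_mset (\<lambda>b. e (M *v b)) (mset_set B) + image_mset e (mset_set C)"
    by (simp add: eig image_mset.compositionality comp_def)
  also have "image_mset (\<lambda>b. e (M *v b)) (mset_set B) = image_mset l (mset_set B)"
    using finB eD by (intro image_mset_cong) simp
  also have "\<dots> = eigenvalues S"
    using eigenvalues_orthonormal_eigenset[OF B(1) cardB] by simp
  finally have A: "eigenvalues A = eigenvalues S + image_mset e (mset_set C)" .
  have S_eig: "eigenvalues S = image_mset l (mset_set B)"
    by (rule eigenvalues_orthonormal_eigenset[OF B(1) cardB])
  \<comment> \<open>The rotation with \<open>c = 0\<close> and \<open>s = 1\<close> replaces
    \<open>M *v b\<close> by the unit vector \<open>w\<close> altogether.\<close>
  have "m w \<le> l b" if "b \<in> B" "w \<in> C" for b w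
  proof -
    have "transpose M *v w = 0" using that CV by (auto simp: V_def)
    from trace_maximizer_rotation[OF sym M max unitB[OF that(1)] this, of 0 1]
    have "w \<bullet> (A *v w) \<le> (M *v b) \<bullet> (A *v (M *v b))"
      using unitC[OF that(2)] by simp
    moreover have "A *v w = m w *\<^sub>R w" "S *v b = l b *\<^sub>R b"
      using that B(1) C(1) by (auto simp: orthonormal_eigenset_def)
    ultimately show ?thesis
      using unitB[OF that(1)] unitC[OF that(2)] stiefel_inner[OF M, of b b]
      by (simp add: AM matrix_vector_mult_scaleR norm_eq_1)
  qed
  then have "mset (take (size (eigenvalues S)) (eigenvalues_desc A)) = eigenvalues S"
    unfolding eigenvalues_desc_def A
    by (intro take_size_rev_sorted_list_of_multiset) (auto simp: S_eig finB finC e_def)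
  moreover have "size (eigenvalues S) = CARD('k)"
    by (simp add: S_eig cardB)
  ultimately show "eigenvalues S = mset (take CARD('k) (eigenvalues_desc A))" by simp
qed

section \<open>From the Ansatz to trace maximality\<close>

theorem theorem6p3:
  fixes f :: "real^'k^'n \<Rightarrow> real"
    and H :: "real^'k^'n \<Rightarrow> real^'n^'n"
    and PP :: "(real^'k^'n) set"
    and N :: "real^'k^'k \<Rightarrow> real"
    and \<delta> :: real
    and P\<^sub>0 :: "real^'k^'n"
  assumes "1 \<le> CARD('k)" and "CARD('k) \<le> CARD('n)"
    and "matrix_norm N" and "0 < \<delta>"
    and "f differentiable_on stiefel_nbhd N \<delta>"
    and "is_arg_max f (\<lambda>P. P \<in> stiefel) P\<^sub>0"
    and "\<And>P. P \<in> stiefel \<Longrightarrow> transpose (H P) = H P"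
    and "PP \<subseteq> stiefel"
    and "nepv_ansatz f H PP"
    and "P\<^sub>0 \<in> PP"
  defines "\<Omega> \<equiv> transpose P\<^sub>0 ** H P\<^sub>0 ** P\<^sub>0"
  shows "H P\<^sub>0 ** P\<^sub>0 = P\<^sub>0 ** \<Omega> \<and>
         eigenvalues \<Omega> = mset (take CARD('k) (eigenvalues_desc (H P\<^sub>0)))"
proof -
  have P: "P\<^sub>0 \<in> stiefel" and max: "\<And>P. P \<in> stiefel \<Longrightarrow> f P \<le> f P\<^sub>0"
    using assms(6) by (auto simp: is_arg_max_linorder)
  have sym: "transpose (H P\<^sub>0) = H P\<^sub>0" using assms(7) P by blast
  have "trace (transpose P ** H P\<^sub>0 ** P) \<le> trace (transpose P\<^sub>0 ** H P\<^sub>0 ** P\<^sub>0)"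
    if P': "P \<in> stiefel" for P :: "real^'k^'n"
  proof -
    \<comment> \<open>The exact trace gap, so that the premise of the Ansatz holds with
      equality.\<close>
    define \<eta> where "\<eta> = trace (transpose P ** H P\<^sub>0 ** P) - trace (transpose P\<^sub>0 ** H P\<^sub>0 ** P\<^sub>0)"
    then have le: "trace (transpose P\<^sub>0 ** H P\<^sub>0 ** P\<^sub>0) + \<eta> \<le> trace (transpose P ** H P\<^sub>0 ** P)"
      by simp
    obtain \<omega> where "\<omega> > 0" and "\<exists>Q\<in>(stiefel :: (real^'k^'k) set).
        P ** Q \<in> PP \<and> f (P ** Q) \<ge> f P\<^sub>0 + \<omega> * \<eta>"
      using assms(9,10) P' le unfolding nepv_ansatz_def by blast
    then obtain Q :: "real^'k^'k" where "P ** Q \<in> stiefel" "f (P ** Q) \<ge> f P\<^sub>0 + \<omega> * \<eta>"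
      using assms(8) by blast
    \<comment> \<open>A positive gap would make \<open>f (P ** Q)\<close> exceed the maximum
      \<open>f P\<^sub>0\<close>.\<close>
    then have "\<omega> * \<eta> \<le> 0" using max[of "P ** Q"] by linarith
    then show ?thesis
      using \<open>\<omega> > 0\<close> by (simp add: \<eta>_def mult_le_0_iff)
  qed
  from trace_maximizer_eigenvalues[OF sym P this] show ?thesis
    unfolding \<Omega>_def by blast
qed

end
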